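(* Let $I=[0,1]$ and let $G$ be a closed relation on $I$. If there are well-aligned closed subsets $L,R$ of $G$, or if there are well-aligned closed subsets $L,R$ of $G^{-1}$, then $\mathrm{ent}(G)\neq 0$.
   Context: A closed relation on a compact metric space $X$ is a closed subset $G\subseteq X\times X$; $G^{-1}=\{(y,x) : (x,y)\in G\}$. For a positive integer $m$, the $m$-th Mahavier product is $\star_{i=1}^{m}G^{-1}=\{(x_1,\dots,x_{m+1})\in X^{m+1} : (x_{i+1},x_i)\in G \text{ for } i=1,\dots,m\}$. For an open cover $\alpha$ of $X$, $\alpha^{n}=\{A_1\times\dots\times A_n : A_1,\dots,A_n\in\alpha\}$, and for closed $K\subseteq X^n$, $N(K,\alpha^n)$ is the minimal cardinality of a subfamily of $\alpha^n$ whose union contains $K$. For $G\ne\emptyset$, $\mathrm{ent}(G,\alpha)=\lim_{m\to\infty}\frac{1}{m}\log N(\star_{i=1}^mG^{-1},\alpha^{m+1})$ (convention: $\log 0:=0$, relevant only if a Mahavier product is empty; the limit exists). The entropy is $\mathrm{ent}(G)=\sup\{\mathrm{ent}(G,\alpha) : \alpha \text{ an open cover of } X\}\in[0,\infty]$ if $G\neq\emptyset$, and $\mathrm{ent}(\emptyset)=0$. Let $p_1,p_2:I\times I\to I$ be the projections $p_1(s,t)=s$, $p_2(s,t)=t$. Put $\Delta^{+}=\{(x,y)\in I\times I : y>x\}$, $\Delta^{-}=\{(x,y)\in I\times I : y<x\}$, $\Delta=\{(x,y)\in I\times I : y=x\}$. For $A\subseteq I\times I$ and $b\in(0,1)$ put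 $A_b^{+}=\{(x,y)\in A : y>b\}$, $A_b^{-}=\{(x,y)\in A : y<b\}$, $A_b=\{(x,y)\in A : y=b\}$. Closed subsets $L,R$ of $I\times I$ are well-aligned by $b\in(0,1)$ if: (1) $L_b^{+}\neq\emptyset$, $L_b^{-}\cup L_b\neq\emptyset$ and $R=R_b\cup R_b^{-}$; (2) $L_b^{+}\cup L_b\subseteq\Delta^{+}$, $L_b^{-}\subseteq\Delta^{+}\cup\Delta$ and $R\subseteq\Delta^{-}$; (3) $p_2(L_b^{-}\cup L_b)\cup p_1(L_b^{-}\cup L_b)\subseteq p_2(R)$; (4) $p_1(L_b^{+})\cup p_1(R)\subseteq p_2(L)$. They are well-aligned if they are well-aligned by some $b\in(0,1)$. *)

theory Defs
  imports "HOL-Analysis.Analysis"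
begin

subsection \<open>Topological entropy of closed relations\<close>

definition closed_relation_on :: "'a::metric_space set \<Rightarrow> ('a \<times> 'a) set \<Rightarrow> bool" where
  "closed_relation_on X G \<longleftrightarrow> closedin (top_of_set (X \<times> X)) G"

text \<open>Points of the power of \<open>X\<close> with exponent \<open>n\<close> are extensional functions on \<open>{1..n}\<close>.
  The entropy below uses the Mahavier product of the inverse relation \<open>G\<inverse>\<close>, whose
  condition \<open>(x i, x (i + 1)) \<in> G\<inverse>\<close> says \<open>(x (i + 1), x i) \<in> G\<close>.\<close>

definition mahavier_product :: "'a set \<Rightarrow> ('a \<times> 'a) set \<Rightarrow> nat \<Rightarrow> (nat \<Rightarrow> 'a) set" where
  "mahavier_product X H m =
     {x \<in> {1..m + 1} \<rightarrow>\<^sub>E X. \<forall>i\<in>{1..m}. (x i, x (i + 1)) \<in> H}"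

definition open_cover :: "'a::metric_space set \<Rightarrow> 'a set set \<Rightarrow> bool" where
  "open_cover X \<alpha> \<longleftrightarrow> (\<forall>A\<in>\<alpha>. openin (top_of_set X) A) \<and> \<Union>\<alpha> = X"

definition cover_power :: "'a set set \<Rightarrow> nat \<Rightarrow> (nat \<Rightarrow> 'a) set set" where
  "cover_power \<alpha> n = {Pi\<^sub>E {1..n} A | A. \<forall>i\<in>{1..n}. A i \<in> \<alpha>}"

text \<open>Only finite subfamilies are considered, since \<open>card\<close> is \<open>0\<close> on infinite sets. For an open
  cover of a compact space and closed \<open>K\<close>, a finite subfamily covering \<open>K\<close> exists.\<close>

definition min_cover_number :: "'b set \<Rightarrow> 'b set set \<Rightarrow> nat" where
  "min_cover_number K \<C> =
     (LEAST k. \<exists>\<F>. \<F> \<subseteq> \<C> \<and> finite \<F> \<and> K \<subseteq> \<Union>\<F> \<and> card \<F> = k)"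

text \<open>The convention that the logarithm of \<open>0\<close> is \<open>0\<close> is built into \<open>ln\<close>.\<close>

definition ent_cover :: "'a::metric_space set \<Rightarrow> ('a \<times> 'a) set \<Rightarrow> 'a set set \<Rightarrow> real" where
  "ent_cover X G \<alpha> =
     lim (\<lambda>m. 1 / real m *
       ln (real (min_cover_number (mahavier_product X (G\<inverse>) m) (cover_power \<alpha> (m + 1)))))"

definition ent :: "'a::metric_space set \<Rightarrow> ('a \<times> 'a) set \<Rightarrow> ereal" where
  "ent X G = (if G = {} then 0 else (SUP \<alpha>\<in>{\<alpha>. open_cover X \<alpha>}. ereal (ent_cover X G \<alpha>)))"

subsection \<open>Well-aligned sets\<close>

abbreviation unit_I :: "real set" where
  "unit_I \<equiv> {0..1}"

definition Delta_above :: "(real \<times> real) set" where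
  "Delta_above = {(x, y) \<in> unit_I \<times> unit_I. y > x}"

definition Delta_below :: "(real \<times> real) set" where
  "Delta_below = {(x, y) \<in> unit_I \<times> unit_I. y < x}"

definition Delta_diag :: "(real \<times> real) set" where
  "Delta_diag = {(x, y) \<in> unit_I \<times> unit_I. y = x}"

definition part_above :: "(real \<times> real) set \<Rightarrow> real \<Rightarrow> (real \<times> real) set" where
  "part_above A b = {(x, y) \<in> A. y > b}"

definition part_below :: "(real \<times> real) set \<Rightarrow> real \<Rightarrow> (real \<times> real) set" where
  "part_below A b = {(x, y) \<in> A. y < b}"

definition part_at :: "(real \<times> real) set \<Rightarrow> real \<Rightarrow> (real \<times> real) set" where
  "part_at A b = {(x, y) \<in> A. y = b}"

definition well_aligned_by :: "real \<Rightarrow> (real \<times> real) set \<Rightarrow> (real \<times> real) set \<Rightarrow> bool" where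
  "well_aligned_by b L R \<longleftrightarrow>
     closedin (top_of_set (unit_I \<times> unit_I)) L \<and>
     closedin (top_of_set (unit_I \<times> unit_I)) R \<and>
     b \<in> {0<..<1} \<and>
     (part_above L b \<noteq> {} \<and> part_below L b \<union> part_at L b \<noteq> {} \<and>
       R = part_at R b \<union> part_below R b) \<and>
     (part_above L b \<union> part_at L b \<subseteq> Delta_above \<and>
       part_below L b \<subseteq> Delta_above \<union> Delta_diag \<and>
       R \<subseteq> Delta_below) \<and>
     snd ` (part_below L b \<union> part_at L b) \<union> fst ` (part_below L b \<union> part_at L b) \<subseteq> snd ` R \<and>
     fst ` part_above L b \<union> fst ` R \<subseteq> snd ` L"

definition well_aligned :: "(real \<times> real) set \<Rightarrow> (real \<times> real) set \<Rightarrow> bool" where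
  "well_aligned L R \<longleftrightarrow> (\<exists>b. well_aligned_by b L R)"

end

theory Submission
  imports Defs
begin

text \<open>
  Read a point \<open>(x, y)\<close> of the relation as a move from \<open>y\<close> to \<open>x\<close>, which is the direction in which the
  Mahavier product of \<open>G\<inverse>\<close> is traversed. For sets \<open>L\<close>, \<open>R\<close> well-aligned by \<open>b\<close>, an \<open>L\<close>-move goes
  down, strictly when it starts at or above \<open>b\<close>, and an \<open>R\<close>-move goes strictly up. Call
  \<open>P = snd ` L\<close> the set of states. From a state above \<open>b\<close>, \<open>L\<close>-moves lead through states, and by
  compactness each of them descends by at least a fixed \<open>e > 0\<close>; so a state at or below \<open>b\<close> is
  reached within a bounded number \<open>J\<close> of moves. A state \<open>z \<le> b\<close> offers two continuations: an
  \<open>R\<close>-move, or an \<open>L\<close>-move followed by an \<open>R\<close>-move, and both end in \<open>P\<close> again. Their first moves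
  lead to a point \<open>\<ge> z + d\<close>, with \<open>d > 0\<close> from the compactness of \<open>R\<close>, and to a point \<open>\<le> z\<close>. Hence the two
  futures are told apart at distance \<open>d\<close> at the moment of the choice, and repeating the choice
  yields \<open>2 ^ q\<close> pairwise \<open>d\<close>-separated chains with \<open>q * (J + 2)\<close> moves
  (\<open>well_aligned_separated_chains\<close>, by way of \<open>branches_from_power\<close>).

  For a finite open cover whose members have diameter below \<open>d\<close>, a box of the power cover contains
  at most one chain of a separated family, so the covering number after \<open>q * (J + 2)\<close> moves is at
  least \<open>2 ^ q\<close>. The growth rates converge by Fekete's lemma, because the covering
  numbers are submultiplicative under concatenation (\<open>ent_cover_tendsto\<close>); so their limit is at
  least \<open>ln 2 / (J + 2)\<close> (\<open>ent_pos_of_separated_chains\<close>).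

  Well-aligned subsets of \<open>G\<inverse>\<close> give separated chains for the opposite direction of traversal, and
  reversing each chain preserves both the number and the separation (\<open>separated_rev_chain_lists\<close>).
\<close>

section \<open>Subadditive sequences\<close>

lemma subadditive_mult_le:
  fixes u :: "nat \<Rightarrow> real"
  assumes sub: "\<And>m n. u (m + n) \<le> u m + u n"
  shows "u (q * k + r) \<le> real q * u k + u r"
proof (induction q)
  case (Suc q)
  have "u (Suc q * k + r) = u (k + (q * k + r))" by (simp add: add.assoc)
  also have "\<dots> \<le> u k + u (q * k + r)" by (rule sub)
  finally show ?case using Suc by (simp add: algebra_simps)
qed simp

text \<open>Every index is \<open>n = q * k + r\<close> with \<open>r < k\<close>, so \<open>u n / n\<close> exceeds \<open>u k / k\<close> by at most
  \<open>M / n\<close>, where \<open>M\<close> bounds the finitely many remainders; choosing \<open>k\<close> with \<open>u k / k\<close> close to the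
  infimum identifies the limit.\<close>

lemma fekete_convergent:
  fixes u :: "nat \<Rightarrow> real"
  assumes sub: "\<And>m n. u (m + n) \<le> u m + u n" and nonneg: "\<And>n. 0 \<le> u n"
  shows "convergent (\<lambda>n. u n / real n)"
proof -
  define l where "l = Inf ((\<lambda>n. u n / real n) ` {1..})"
  have bdd: "bdd_below ((\<lambda>n. u n / real n) ` {1..})"
    by (rule bdd_belowI[of _ 0]) (auto simp: nonneg)
  have "(\<lambda>n. u n / real n) \<longlonglongrightarrow> l"
  proof (rule LIMSEQ_I)
    fix e :: real assume e: "0 < e"
    obtain k where k: "k \<ge> 1" "u k / real k < l + e / 2"
      using cInf_lessD[of "(\<lambda>n. u n / real n) ` {1..}" "l + e / 2"] e
      by (auto simp: l_def)
    define M where "M = (\<Sum>r<k. u r)"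
    have M: "u r \<le> M" if "r < k" for r
      unfolding M_def using that by (intro member_le_sum) (auto simp: nonneg)
    obtain n0 :: nat where n0: "2 * M / e < real n0" using reals_Archimedean2 by blast
    have "norm (u n / real n - l) < e" if n: "n \<ge> Suc n0" for n
    proof -
      have npos: "real n > 0" using n by simp
      have lower: "l \<le> u n / real n"
        unfolding l_def by (rule cInf_lower[OF _ bdd]) (use n in auto)
      have "u n = u (n div k * k + n mod k)" by simp
      also have "\<dots> \<le> real (n div k) * u k + u (n mod k)"
        by (rule subadditive_mult_le[OF sub])
      also have "\<dots> \<le> real (n div k) * u k + M"
        using M[of "n mod k"] k by simp
      also have "real (n div k) * u k \<le> real n / real k * u k"
        by (intro mult_right_mono of_nat_div_le_of_nat nonneg)
      finally have "u n / real n \<le> (real n / real k * u k + M) / real n"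
        using npos by (intro divide_right_mono) auto
      also have "\<dots> = u k / real k + M / real n" using npos k by (simp add: field_simps)
      also have "M / real n < e / 2"
      proof -
        have "2 * M / e < real n" using n0 n by linarith
        thus ?thesis using npos e by (simp add: field_simps)
      qed
      finally have "u n / real n < l + e" using k by simp
      thus ?thesis using lower by simp
    qed
    thus "\<exists>no. \<forall>n\<ge>no. norm (u n / real n - l) < e" by blast
  qed
  thus ?thesis by (rule convergentI)
qed

section \<open>Growth of the covering numbers\<close>

lemma finite_cover_power:
  assumes "finite \<alpha>"
  shows "finite (cover_power \<alpha> n)"
proof -
  have "cover_power \<alpha> n \<subseteq> Pi\<^sub>E {1..n} ` ({1..n} \<rightarrow>\<^sub>E \<alpha>)"
  proof
    fix U assume "U \<in> cover_power \<alpha> n"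
    then obtain A where A: "U = Pi\<^sub>E {1..n} A" "\<forall>i\<in>{1..n}. A i \<in> \<alpha>"
      by (auto simp: cover_power_def)
    have "U = Pi\<^sub>E {1..n} (restrict A {1..n})" unfolding A(1) by (rule PiE_cong) simp
    thus "U \<in> Pi\<^sub>E {1..n} ` ({1..n} \<rightarrow>\<^sub>E \<alpha>)" using A(2) by auto
  qed
  thus ?thesis using finite_subset assms by (metis finite_PiE finite_atLeastAtMost finite_imageI)
qed

lemma cover_power_covers:
  assumes "\<Union>\<alpha> = X"
  shows "mahavier_product X H m \<subseteq> \<Union>(cover_power \<alpha> (m + 1))"
proof
  fix x assume "x \<in> mahavier_product X H m"
  hence x: "x \<in> {1..m + 1} \<rightarrow>\<^sub>E X" by (simp add: mahavier_product_def)
  hence "\<forall>i\<in>{1..m + 1}. \<exists>A. A \<in> \<alpha> \<and> x i \<in> A" using assms by blast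
  then obtain A where A: "\<forall>i\<in>{1..m + 1}. A i \<in> \<alpha> \<and> x i \<in> A i" by metis
  hence "x \<in> Pi\<^sub>E {1..m + 1} A" using x by (auto simp: PiE_iff)
  thus "x \<in> \<Union>(cover_power \<alpha> (m + 1))" using A by (auto simp: cover_power_def)
qed

text \<open>Without a finite subcover the \<open>LEAST\<close> in the definition of the covering number would be
  arbitrary. Here the family itself is a finite cover, which is why only finite covers are used
  below.\<close>

lemma min_cover_number_attained:
  assumes "finite \<C>" "K \<subseteq> \<Union>\<C>"
  obtains \<F> where "\<F> \<subseteq> \<C>" "finite \<F>" "K \<subseteq> \<Union>\<F>" "card \<F> = min_cover_number K \<C>"
proof -
  have "\<exists>k \<F>. \<F> \<subseteq> \<C> \<and> finite \<F> \<and> K \<subseteq> \<Union>\<F> \<and> card \<F> = k" using assms by blast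
  from LeastI_ex[OF this] show ?thesis using that unfolding min_cover_number_def by blast
qed

lemma min_cover_number_le:
  assumes "\<F> \<subseteq> \<C>" "finite \<F>" "K \<subseteq> \<Union>\<F>"
  shows "min_cover_number K \<C> \<le> card \<F>"
  unfolding min_cover_number_def by (rule Least_le) (use assms in blast)

text \<open>A covering subfamily must use a different member for each point of \<open>S\<close>.\<close>

lemma min_cover_number_ge_card:
  assumes "finite \<C>" "K \<subseteq> \<Union>\<C>" "S \<subseteq> K"
    and one: "\<And>U x y. U \<in> \<C> \<Longrightarrow> x \<in> S \<Longrightarrow> y \<in> S \<Longrightarrow> x \<in> U \<Longrightarrow> y \<in> U \<Longrightarrow> x = y"
  shows "card S \<le> min_cover_number K \<C>"
proof -
  obtain \<F> where F: "\<F> \<subseteq> \<C>" "finite \<F>" "K \<subseteq> \<Union>\<F>" "card \<F> = min_cover_number K \<C>"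
    using min_cover_number_attained[OF assms(1,2)] .
  have "\<forall>x\<in>S. \<exists>U\<in>\<F>. x \<in> U" using F(3) assms(3) by blast
  then obtain f where f: "\<And>x. x \<in> S \<Longrightarrow> f x \<in> \<F> \<and> x \<in> f x" by metis
  have "inj_on f S" by (rule inj_onI) (metis F(1) f one subsetD)
  hence "card S \<le> card \<F>" using F(2) f by (intro card_inj_on_le) auto
  thus ?thesis using F(4) by simp
qed

text \<open>The set of concatenations of a word of length \<open>p\<close> from \<open>U\<close> with one of length \<open>q\<close> from \<open>V\<close>. It is
  described by restrictions of the concatenated word, so that it is defined for arbitrary sets and
  not only for boxes.\<close>

definition append_sets ::
    "nat \<Rightarrow> nat \<Rightarrow> (nat \<Rightarrow> 'a) set \<Rightarrow> (nat \<Rightarrow> 'a) set \<Rightarrow> (nat \<Rightarrow> 'a) set" where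
  "append_sets p q U V = {x \<in> extensional {1..p + q}.
     restrict x {1..p} \<in> U \<and> (\<lambda>i\<in>{1..q}. x (p + i)) \<in> V}"

lemma append_sets_in_cover_power:
  assumes "U \<in> cover_power \<alpha> p" "V \<in> cover_power \<alpha> q"
  shows "append_sets p q U V \<in> cover_power \<alpha> (p + q)"
proof -
  obtain A where A: "U = Pi\<^sub>E {1..p} A" "\<forall>i\<in>{1..p}. A i \<in> \<alpha>"
    using assms(1) by (auto simp: cover_power_def)
  obtain B where B: "V = Pi\<^sub>E {1..q} B" "\<forall>i\<in>{1..q}. B i \<in> \<alpha>"
    using assms(2) by (auto simp: cover_power_def)
  define C where "C = (\<lambda>i. if i \<le> p then A i else B (i - p))"
  have split: "(\<forall>i\<in>{1..p + q}. Q i) \<longleftrightarrow> (\<forall>i\<in>{1..p}. Q i) \<and> (\<forall>i\<in>{1..q}. Q (p + i))" for Q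
  proof (intro iffI conjI ballI)
    fix i assume *: "(\<forall>i\<in>{1..p}. Q i) \<and> (\<forall>i\<in>{1..q}. Q (p + i))" "i \<in> {1..p + q}"
    show "Q i"
    proof (cases "i \<le> p")
      case False
      hence "i - p \<in> {1..q}" "p + (i - p) = i" using *(2) by auto
      thus ?thesis using * by metis
    qed (use * in auto)
  qed auto
  have "append_sets p q U V = Pi\<^sub>E {1..p + q} C"
  proof (rule set_eqI)
    fix x
    have in_C: "x \<in> Pi\<^sub>E {1..p + q} C \<longleftrightarrow> (\<forall>i\<in>{1..p}. x i \<in> A i) \<and> (\<forall>i\<in>{1..q}. x (p + i) \<in> B i) \<and>
        x \<in> extensional {1..p + q}"
      unfolding PiE_iff split by (simp add: C_def)
    show "x \<in> append_sets p q U V \<longleftrightarrow> x \<in> Pi\<^sub>E {1..p + q} C"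
      unfolding in_C by (auto simp: append_sets_def A(1) B(1) PiE_iff)
  qed
  moreover have "\<forall>i\<in>{1..p + q}. C i \<in> \<alpha>"
    unfolding split using A(2) B(2) by (auto simp: C_def)
  ultimately show ?thesis by (auto simp: cover_power_def)
qed

text \<open>A chain with \<open>m + n + 1\<close> moves has \<open>(m + 1) + (n + 1)\<close> points; forgetting the move in the middle
  splits it into a chain with \<open>m\<close> moves and one with \<open>n\<close> moves. The products of the boxes that cover the
  two parts cover the whole.\<close>

lemma min_cover_number_mahavier_submult:
  assumes fin: "finite \<alpha>" and cov: "\<Union>\<alpha> = X"
  shows "min_cover_number (mahavier_product X H (m + n + 1)) (cover_power \<alpha> (m + n + 2))
    \<le> min_cover_number (mahavier_product X H m) (cover_power \<alpha> (m + 1)) *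
      min_cover_number (mahavier_product X H n) (cover_power \<alpha> (n + 1))"
proof -
  obtain \<F> where F: "\<F> \<subseteq> cover_power \<alpha> (m + 1)" "finite \<F>" "mahavier_product X H m \<subseteq> \<Union>\<F>"
      "card \<F> = min_cover_number (mahavier_product X H m) (cover_power \<alpha> (m + 1))"
    using min_cover_number_attained[OF finite_cover_power[OF fin] cover_power_covers[OF cov]] .
  obtain \<G> where G: "\<G> \<subseteq> cover_power \<alpha> (n + 1)" "finite \<G>" "mahavier_product X H n \<subseteq> \<Union>\<G>"
      "card \<G> = min_cover_number (mahavier_product X H n) (cover_power \<alpha> (n + 1))"
    using min_cover_number_attained[OF finite_cover_power[OF fin] cover_power_covers[OF cov]] .
  define \<A> where "\<A> = (\<lambda>(U, V). append_sets (m + 1) (n + 1) U V) ` (\<F> \<times> \<G>)"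
  have "\<A> \<subseteq> cover_power \<alpha> (m + n + 2)"
  proof
    fix W assume "W \<in> \<A>"
    then obtain U V where W: "W = append_sets (m + 1) (n + 1) U V" "U \<in> \<F>" "V \<in> \<G>"
      by (auto simp: \<A>_def)
    have "W \<in> cover_power \<alpha> ((m + 1) + (n + 1))"
      unfolding W(1) using W(2,3) F(1) G(1) by (intro append_sets_in_cover_power) auto
    thus "W \<in> cover_power \<alpha> (m + n + 2)" by (simp add: add.commute add.left_commute)
  qed
  moreover have "mahavier_product X H (m + n + 1) \<subseteq> \<Union>\<A>"
  proof
    fix x assume "x \<in> mahavier_product X H (m + n + 1)"
    hence x: "x \<in> {1..m + n + 2} \<rightarrow>\<^sub>E X" and xH: "\<And>i. i \<in> {1..m + n + 1} \<Longrightarrow> (x i, x (i + 1)) \<in> H"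
      by (auto simp: mahavier_product_def)
    have xX: "x i \<in> X" if "1 \<le> i" "i \<le> m + n + 2" for i using x that by auto
    define y where "y = restrict x {1..m + 1}"
    define z where "z = (\<lambda>i\<in>{1..n + 1}. x (m + 1 + i))"
    have "y \<in> mahavier_product X H m"
      unfolding mahavier_product_def y_def using xX xH by auto
    then obtain U where U: "U \<in> \<F>" "y \<in> U" using F(3) by blast
    have "z \<in> mahavier_product X H n"
    proof -
      have "(x (m + 1 + i), x (m + 1 + (i + 1))) \<in> H" if "i \<in> {1..n}" for i
        using xH[of "m + 1 + i"] that by simp
      moreover have "x (m + 1 + i) \<in> X" if "i \<in> {1..n + 1}" for i
        using xX[of "m + 1 + i"] that by simp
      ultimately show ?thesis unfolding mahavier_product_def z_def by simp
    qed
    then obtain V where V: "V \<in> \<G>" "z \<in> V" using G(3) by blast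
    have "x \<in> extensional {1..m + n + 2}" using x by (simp add: PiE_iff)
    hence "x \<in> append_sets (m + 1) (n + 1) U V"
      using U V unfolding append_sets_def y_def z_def by (simp add: add.commute add.left_commute)
    thus "x \<in> \<Union>\<A>" using U(1) V(1) by (auto simp: \<A>_def)
  qed
  ultimately have "min_cover_number (mahavier_product X H (m + n + 1)) (cover_power \<alpha> (m + n + 2))
      \<le> card \<A>"
    using F(2) G(2) by (intro min_cover_number_le) (auto simp: \<A>_def)
  also have "\<dots> \<le> card (\<F> \<times> \<G>)" unfolding \<A>_def using F(2) G(2) by (intro card_image_le) simp
  finally show ?thesis using F(4) G(4) by (simp add: card_cartesian_product)
qed

text \<open>The definition of \<open>ent_cover\<close> by \<open>lim\<close> says something only if the limit exists. Since the
  splitting of chains adds one to the number of moves, the sequence that is subadditive is indexed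
  by the number of points, and the limit has to be carried over by the factor \<open>(m + 1) / m\<close>.\<close>

lemma ent_cover_tendsto:
  fixes X :: "'a::metric_space set"
  assumes fin: "finite \<alpha>" and cov: "\<Union>\<alpha> = X"
  shows "(\<lambda>m. 1 / real m *
      ln (real (min_cover_number (mahavier_product X (G\<inverse>) m) (cover_power \<alpha> (m + 1)))))
    \<longlonglongrightarrow> ent_cover X G \<alpha>"
proof -
  define N where "N = (\<lambda>m. min_cover_number (mahavier_product X (G\<inverse>) m) (cover_power \<alpha> (m + 1)))"
  \<comment> \<open>Truncated subtraction makes \<open>u 0 = u 1 \<ge> 0\<close>, so subadditivity also holds at \<open>0\<close>.\<close>
  define u where "u = (\<lambda>n. ln (real (N (n - 1))))"
  have nonneg: "0 \<le> u n" for n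
    by (cases "N (n - 1)") (auto simp: u_def)
  \<comment> \<open>If the longer product is empty, the left-hand side is \<open>ln 0 = 0\<close>.\<close>
  have step: "ln (real (N (m + n + 1))) \<le> ln (real (N m)) + ln (real (N n))" for m n
  proof (cases "N (m + n + 1) = 0")
    case True
    thus ?thesis using nonneg[of "Suc m"] nonneg[of "Suc n"] by (simp add: u_def)
  next
    case False
    have le: "N (m + n + 1) \<le> N m * N n"
      using min_cover_number_mahavier_submult[OF fin cov, of "G\<inverse>" m n] by (simp add: N_def)
    with False have "N m * N n \<noteq> 0" by linarith
    hence pos: "N m > 0" "N n > 0" by simp_all
    have "ln (real (N (m + n + 1))) \<le> ln (real (N m) * real (N n))"
      using False le pos by (subst ln_le_cancel_iff) (auto simp flip: of_nat_mult)
    thus ?thesis using pos by (simp add: ln_mult)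
  qed
  have "u (m + n) \<le> u m + u n" for m n
  proof (cases "m = 0 \<or> n = 0")
    case True
    thus ?thesis using nonneg[of 0] by auto
  next
    case False
    then obtain m' n' where "m = Suc m'" "n = Suc n'" by (meson not0_implies_Suc)
    thus ?thesis using step[of m' n'] by (simp add: u_def)
  qed
  then obtain l where "(\<lambda>n. u n / real n) \<longlonglongrightarrow> l"
    using fekete_convergent[of u] nonneg convergent_def by blast
  hence "(\<lambda>m. u (Suc m) / real (Suc m)) \<longlonglongrightarrow> l" by (rule LIMSEQ_Suc)
  moreover have "(\<lambda>m. 1 + 1 / real m) \<longlonglongrightarrow> 1"
    using tendsto_add[OF tendsto_const lim_1_over_n, of 1] by simp
  ultimately have "(\<lambda>m. u (Suc m) / real (Suc m) * (1 + 1 / real m)) \<longlonglongrightarrow> l * 1"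
    by (rule tendsto_mult)
  moreover have "\<forall>\<^sub>F m in sequentially.
      u (Suc m) / real (Suc m) * (1 + 1 / real m) = 1 / real m * ln (real (N m))"
    using eventually_gt_at_top[of 0]
  proof eventually_elim
    case (elim m)
    have "1 + 1 / real m = real (Suc m) / real m" using elim by (simp add: field_simps)
    thus ?case by (simp add: u_def)
  qed
  ultimately have "(\<lambda>m. 1 / real m * ln (real (N m))) \<longlonglongrightarrow> l * 1"
    by (rule Lim_transform_eventually)
  thus ?thesis unfolding ent_cover_def N_def using limI by force
qed

section \<open>Separated chains and positive entropy\<close>

text \<open>The points of the Mahavier product as lists instead of extensional functions: extending a chain
  at the front and reversing it are then list operations without index shifts.\<close>

definition chain_lists :: "'a set \<Rightarrow> ('a \<times> 'a) set \<Rightarrow> nat \<Rightarrow> 'a list set" where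
  "chain_lists X H m =
     {xs. length xs = Suc m \<and> set xs \<subseteq> X \<and> successively (\<lambda>x y. (x, y) \<in> H) xs}"

definition separated :: "real \<Rightarrow> 'a::metric_space list set \<Rightarrow> bool" where
  "separated d S \<longleftrightarrow> pairwise (\<lambda>xs ys. \<exists>(x, y)\<in>set (zip xs ys). d \<le> dist x y) S"

text \<open>Reversal exchanges a relation with its inverse; this transfers lower bounds for the growth from
  one direction of traversal to the other.\<close>

lemma separated_rev_chain_lists:
  assumes "S \<subseteq> chain_lists X H m" "separated d S"
  shows "rev ` S \<subseteq> chain_lists X (H\<inverse>) m" "separated d (rev ` S)" "card (rev ` S) = card S"
proof -
  show "rev ` S \<subseteq> chain_lists X (H\<inverse>) m" using assms(1) by (fastforce simp: chain_lists_def)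
  show "separated d (rev ` S)"
    unfolding separated_def
  proof (rule pairwise_imageI)
    fix xs ys assume *: "xs \<in> S" "ys \<in> S" "xs \<noteq> ys" "rev xs \<noteq> rev ys"
    have "length zs = Suc m" if "zs \<in> S" for zs using that assms(1) by (auto simp: chain_lists_def)
    hence "length xs = length ys" using *(1,2) by metis
    thus "\<exists>(x, y)\<in>set (zip (rev xs) (rev ys)). d \<le> dist x y"
      using * assms(2) by (simp add: zip_rev separated_def pairwise_def)
  qed
  show "card (rev ` S) = card S" by (intro card_image) (simp add: inj_on_def)
qed

text \<open>Two separated chains differ by at least \<open>d\<close> in some coordinate, where the side of a box has
  diameter less than \<open>d\<close>; so no box contains both.\<close>

lemma cover_number_ge_card_separated:
  fixes X :: "'a::metric_space set"
  assumes fin: "finite \<alpha>" and cov: "\<Union>\<alpha> = X"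
    and small: "\<And>A x y. A \<in> \<alpha> \<Longrightarrow> x \<in> A \<Longrightarrow> y \<in> A \<Longrightarrow> dist x y < d"
    and S: "S \<subseteq> chain_lists X H m" "separated d S"
  shows "card S \<le> min_cover_number (mahavier_product X H m) (cover_power \<alpha> (m + 1))"
proof -
  define f where "f = (\<lambda>xs :: 'a list. \<lambda>i\<in>{1..m + 1}. xs ! (i - 1))"
  have f_nth: "f xs (Suc i) = xs ! i" if "i \<le> m" for xs i using that by (simp add: f_def)
  have len: "length xs = Suc m" if "xs \<in> S" for xs using that S(1) by (auto simp: chain_lists_def)
  have one: "xs = ys" if mem: "U \<in> cover_power \<alpha> (m + 1)" "xs \<in> S" "ys \<in> S" "f xs \<in> U" "f ys \<in> U"
    for U xs ys
  proof (rule ccontr)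
    assume "xs \<noteq> ys"
    with S(2) mem(2,3) obtain x y where xy: "(x, y) \<in> set (zip xs ys)" "d \<le> dist x y"
      by (fastforce simp: separated_def pairwise_def)
    obtain i where i: "i \<le> m" "x = xs ! i" "y = ys ! i"
      using xy(1) len mem(2,3) by (auto simp: in_set_zip less_Suc_eq_le)
    obtain A where A: "U = Pi\<^sub>E {1..m + 1} A" "\<forall>i\<in>{1..m + 1}. A i \<in> \<alpha>"
      using mem(1) by (auto simp: cover_power_def)
    have "Suc i \<in> {1..m + 1}" using i by simp
    hence "f xs (Suc i) \<in> A (Suc i)" "f ys (Suc i) \<in> A (Suc i)" "A (Suc i) \<in> \<alpha>"
      using mem A by blast+
    hence "dist x y < d" using small i by (simp add: f_nth)
    thus False using xy by simp
  qed
  have "inj_on f S"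
  proof (rule inj_onI)
    fix xs ys assume *: "xs \<in> S" "ys \<in> S" "f xs = f ys"
    show "xs = ys"
      by (rule nth_equalityI) (use * len f_nth in \<open>auto simp: less_Suc_eq_le, metis\<close>)
  qed
  hence "card S = card (f ` S)" by (simp add: card_image)
  also have "\<dots> \<le> min_cover_number (mahavier_product X H m) (cover_power \<alpha> (m + 1))"
  proof (rule min_cover_number_ge_card[OF finite_cover_power[OF fin] cover_power_covers[OF cov]])
    show "f ` S \<subseteq> mahavier_product X H m"
    proof
      fix x assume "x \<in> f ` S"
      then obtain xs where xs: "xs \<in> S" "x = f xs" by blast
      hence c: "length xs = Suc m" "set xs \<subseteq> X" "successively (\<lambda>x y. (x, y) \<in> H) xs"
        using S(1) by (auto simp: chain_lists_def)
      have "(x i, x (i + 1)) \<in> H" if "i \<in> {1..m}" for i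
        using successively_nth[OF c(3), of "i - 1"] that c(1) xs(2) by (auto simp: f_def)
      moreover have "x \<in> {1..m + 1} \<rightarrow>\<^sub>E X"
        using c(1,2) xs(2) by (auto simp: f_def intro!: subsetD[OF c(2)] nth_mem)
      ultimately show "x \<in> mahavier_product X H m" by (simp add: mahavier_product_def)
    qed
    show "x = y" if "U \<in> cover_power \<alpha> (m + 1)" "x \<in> f ` S" "y \<in> f ` S" "x \<in> U" "y \<in> U" for U x y
      using that one by blast
  qed
  finally show ?thesis .
qed

lemma finite_small_open_cover:
  fixes X :: "'a::metric_space set"
  assumes "compact X" "0 < d"
  obtains \<alpha> where "finite \<alpha>" "open_cover X \<alpha>"
    "\<And>A x y. A \<in> \<alpha> \<Longrightarrow> x \<in> A \<Longrightarrow> y \<in> A \<Longrightarrow> dist x y < d"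
proof -
  have "0 < d / 2" using assms(2) by simp
  then obtain k where k: "finite k" "X \<subseteq> (\<Union>c\<in>k. ball c (d / 2))"
    using assms(1) unfolding compact_eq_totally_bounded by blast
  show ?thesis
  proof (rule that[of "(\<lambda>c. X \<inter> ball c (d / 2)) ` k"])
    show "open_cover X ((\<lambda>c. X \<inter> ball c (d / 2)) ` k)"
      unfolding open_cover_def using k(2) by (auto simp: openin_open_Int)
    show "dist x y < d" if "A \<in> (\<lambda>c. X \<inter> ball c (d / 2)) ` k" "x \<in> A" "y \<in> A" for A x y
      using that dist_triangle_half_r[of _ x d y] by auto
  qed (use k in simp)
qed

text \<open>As the growth rates converge, it suffices to bound them from below along the multiples of \<open>K\<close>,
  where they are at least \<open>ln (2 ^ q) / (q * K)\<close>.\<close>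

lemma ent_pos_of_separated_chains:
  fixes X :: "'a::metric_space set"
  assumes "compact X" "0 < d" "0 < K" "G \<noteq> {}"
    and sep: "\<And>q. \<exists>S\<subseteq>chain_lists X (G\<inverse>) (q * K). card S = 2 ^ q \<and> separated d S"
  shows "0 < ent X G"
proof -
  obtain \<alpha> where \<alpha>: "finite \<alpha>" "open_cover X \<alpha>"
    "\<And>A x y. A \<in> \<alpha> \<Longrightarrow> x \<in> A \<Longrightarrow> y \<in> A \<Longrightarrow> dist x y < d"
    using finite_small_open_cover[OF assms(1,2)] by blast
  have cov: "\<Union>\<alpha> = X" using \<alpha>(2) by (simp add: open_cover_def)
  define f where "f = (\<lambda>m. 1 / real m *
    ln (real (min_cover_number (mahavier_product X (G\<inverse>) m) (cover_power \<alpha> (m + 1)))))"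
  have lim: "f \<longlonglongrightarrow> ent_cover X G \<alpha>"
    unfolding f_def by (rule ent_cover_tendsto[OF \<alpha>(1) cov])
  have "ln 2 / real K \<le> f (q * K)" if "q \<ge> 1" for q
  proof -
    let ?n = "min_cover_number (mahavier_product X (G\<inverse>) (q * K)) (cover_power \<alpha> (q * K + 1))"
    obtain S where S: "S \<subseteq> chain_lists X (G\<inverse>) (q * K)" "card S = 2 ^ q" "separated d S"
      using sep by blast
    have "2 ^ q \<le> ?n"
      using cover_number_ge_card_separated[OF \<alpha>(1) cov \<alpha>(3) S(1,3)] S(2) by simp
    hence "(2::real) ^ q \<le> real ?n" using of_nat_le_iff[of "2 ^ q" ?n, where ?'a = real] by simp
    hence "ln (2 ^ q) \<le> ln (real ?n)" by (intro ln_mono) auto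
    hence "real q * ln 2 \<le> ln (real ?n)" by (simp add: ln_realpow)
    hence "1 / real (q * K) * (real q * ln 2) \<le> f (q * K)"
      unfolding f_def by (rule mult_left_mono) simp
    thus ?thesis using that assms(3) by simp
  qed
  moreover have "(\<lambda>q. f (q * K)) \<longlonglongrightarrow> ent_cover X G \<alpha>"
    using LIMSEQ_subseq_LIMSEQ[OF lim, of "\<lambda>q. q * K"] assms(3)
    by (simp add: strict_mono_def o_def)
  ultimately have "ln 2 / real K \<le> ent_cover X G \<alpha>"
    by (intro LIMSEQ_le_const) auto
  moreover have "0 < ln 2 / real K" using assms(3) by simp
  ultimately have "0 < ent_cover X G \<alpha>" by linarith
  hence "0 < ereal (ent_cover X G \<alpha>)" by simp
  also have "\<dots> \<le> (SUP \<alpha>\<in>{\<alpha>. open_cover X \<alpha>}. ereal (ent_cover X G \<alpha>))"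
    by (rule SUP_upper) (use \<alpha>(2) in simp)
  finally show ?thesis using assms(4) by (simp add: ent_def)
qed

section \<open>Branching chains\<close>

text \<open>The common starting point makes the number of branches additive when chains from two separated
  successors of a point are joined, and stable when a point is put in front.\<close>

definition branches_from ::
    "'a::metric_space set \<Rightarrow> ('a \<times> 'a) set \<Rightarrow> real \<Rightarrow> nat \<Rightarrow> nat \<Rightarrow> 'a \<Rightarrow> bool" where
  "branches_from X H d k m z \<longleftrightarrow>
     (\<exists>S\<subseteq>chain_lists X H m. finite S \<and> card S = k \<and> (\<forall>xs\<in>S. hd xs = z) \<and> separated d S)"

lemma branches_from_0:
  assumes "z \<in> X"
  shows "branches_from X H d 1 0 z"
  unfolding branches_from_def
  by (rule exI[of _ "{[z]}"]) (use assms in \<open>auto simp: chain_lists_def separated_def\<close>)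

lemma Cons_chain_lists:
  assumes "xs \<in> chain_lists X H m" "hd xs = x" "(z, x) \<in> H" "z \<in> X"
  shows "z # xs \<in> chain_lists X H (Suc m)"
  using assms by (auto simp: chain_lists_def successively_Cons)

lemma separated_Cons:
  assumes "separated d S"
  shows "separated d (Cons z ` S)"
  using assms unfolding separated_def by (auto simp: pairwise_def)

lemma branches_from_step:
  assumes "branches_from X H d k m x" "(z, x) \<in> H" "z \<in> X"
  shows "branches_from X H d k (Suc m) z"
proof -
  obtain S where S: "S \<subseteq> chain_lists X H m" "finite S" "card S = k" "\<forall>xs\<in>S. hd xs = x" "separated d S"
    using assms(1) by (auto simp: branches_from_def)
  have "Cons z ` S \<subseteq> chain_lists X H (Suc m)" using S assms Cons_chain_lists by fastforce
  moreover have "card (Cons z ` S) = k" using S by (simp add: card_image)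
  ultimately show ?thesis
    unfolding branches_from_def using S(2) separated_Cons[OF S(5), of z]
    by (intro exI[of _ "Cons z ` S"]) auto
qed

lemma branches_from_fork:
  assumes "branches_from X H d k m x" "branches_from X H d l m y"
    and H: "(z, x) \<in> H" "(z, y) \<in> H" "z \<in> X" and d: "d \<le> dist x y" "0 < d"
  shows "branches_from X H d (k + l) (Suc m) z"
proof -
  obtain S where S: "S \<subseteq> chain_lists X H m" "finite S" "card S = k" "\<forall>xs\<in>S. hd xs = x" "separated d S"
    using assms(1) by (auto simp: branches_from_def)
  obtain T where T: "T \<subseteq> chain_lists X H m" "finite T" "card T = l" "\<forall>xs\<in>T. hd xs = y" "separated d T"
    using assms(2) by (auto simp: branches_from_def)
  have apart: "\<exists>(a, b)\<in>set (zip xs ys). d \<le> dist a b" "\<exists>(a, b)\<in>set (zip ys xs). d \<le> dist a b"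
    if xs: "xs \<in> S" and ys: "ys \<in> T" for xs ys
  proof -
    have "xs \<noteq> []" "ys \<noteq> []" using xs ys S(1) T(1) by (auto simp: chain_lists_def)
    then obtain xs' ys' where eqs: "xs = x # xs'" "ys = y # ys'"
      using xs ys S(4) T(4) by (metis list.collapse)
    show "\<exists>(a, b)\<in>set (zip xs ys). d \<le> dist a b" using d by (auto simp: eqs)
    show "\<exists>(a, b)\<in>set (zip ys xs). d \<le> dist a b" using d by (auto simp: eqs dist_commute)
  qed
  have "S \<inter> T = {}" using S(4) T(4) d by auto
  hence "card (Cons z ` (S \<union> T)) = k + l"
    using S(2,3) T(2,3) by (simp add: card_image card_Un_disjoint)
  moreover have "Cons z ` (S \<union> T) \<subseteq> chain_lists X H (Suc m)"
    using S(1,4) T(1,4) Cons_chain_lists[OF _ _ H(1,3)] Cons_chain_lists[OF _ _ H(2,3)] by blast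
  moreover have "separated d (S \<union> T)"
    using S(5) T(5) apart unfolding separated_def pairwise_def by (metis (no_types, lifting) Un_iff)
  hence "separated d (Cons z ` (S \<union> T))" by (rule separated_Cons)
  ultimately show ?thesis
    unfolding branches_from_def using S(2) T(2) by (intro exI[of _ "Cons z ` (S \<union> T)"]) auto
qed

text \<open>Above the threshold \<open>b\<close> the only guaranteed move is a descent by \<open>e\<close>. It spends one move and keeps
  the number of branches, so after at most \<open>j\<close> moves the bound known below \<open>b\<close> applies.\<close>

lemma branches_from_descent:
  fixes P :: "real set"
  assumes "P \<subseteq> X"
    and down: "\<And>z. z \<in> P \<Longrightarrow> b < z \<Longrightarrow> \<exists>x\<in>P. (z, x) \<in> H \<and> x \<le> z - e"
    and low: "\<And>z m. z \<in> P \<Longrightarrow> z \<le> b \<Longrightarrow> M \<le> m \<Longrightarrow> branches_from X H d k m z"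
    and "z \<in> P" "z \<le> b + real j * e" "M + j \<le> m"
  shows "branches_from X H d k m z"
  using assms(4-6)
proof (induction j arbitrary: z m)
  case 0
  thus ?case using low by simp
next
  case (Suc j)
  show ?case
  proof (cases "z \<le> b")
    case True
    thus ?thesis using low Suc.prems by simp
  next
    case False
    then obtain x where x: "x \<in> P" "(z, x) \<in> H" "x \<le> z - e" using down Suc.prems by force
    obtain m' where m': "m = Suc m'" using Suc.prems(3) by (cases m) auto
    have "branches_from X H d k m' x"
      using Suc.prems m' x by (intro Suc.IH) (auto simp: algebra_simps)
    thus ?thesis using x Suc.prems assms(1) unfolding m' by (blast intro: branches_from_step)
  qed
qed

text \<open>At a state \<open>z \<le> b\<close> the direct way up and the detour down are at distance at least \<open>d\<close> after one
  move. The point \<open>x\<close> of the detour need not be a state; one more move returns to \<open>P\<close>, which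
  accounts for the \<open>2\<close> in the time bound.\<close>

lemma branches_from_double:
  fixes P :: "real set"
  assumes "P \<subseteq> X" "0 < d"
    and up: "\<And>z. z \<in> P \<Longrightarrow> z \<le> b \<Longrightarrow> \<exists>x\<in>P. (z, x) \<in> H \<and> z + d \<le> x"
    and loop: "\<And>z. z \<in> P \<Longrightarrow> z \<le> b \<Longrightarrow> \<exists>x\<in>X. \<exists>y\<in>P. (z, x) \<in> H \<and> x \<le> z \<and> (x, y) \<in> H"
    and IH: "\<And>z m. z \<in> P \<Longrightarrow> M \<le> m \<Longrightarrow> branches_from X H d k m z"
    and z: "z \<in> P" "z \<le> b" "M + 2 \<le> m"
  shows "branches_from X H d (2 * k) m z"
proof -
  define m' where "m' = m - 2"
  have m': "m = Suc (Suc m')" "M \<le> m'" using z(3) by (auto simp: m'_def)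
  obtain x where x: "x \<in> P" "(z, x) \<in> H" "z + d \<le> x" using up z by blast
  obtain y y' where y: "y \<in> X" "y' \<in> P" "(z, y) \<in> H" "y \<le> z" "(y, y') \<in> H" using loop z by blast
  have "branches_from X H d k (Suc m') x" using IH x m' by simp
  moreover have "branches_from X H d k (Suc m') y"
    using y IH m' by (intro branches_from_step[of _ _ _ _ _ y']) auto
  moreover have "d \<le> dist x y" using x y by (simp add: dist_real_def)
  ultimately have "branches_from X H d (k + k) (Suc (Suc m')) z"
    using x y z assms(1,2) by (intro branches_from_fork) auto
  thus ?thesis using m' by (simp add: mult_2)
qed

text \<open>The assertion is made for all lengths \<open>m \<ge> q * (J + 2)\<close>, since different
  histories take different times to return to a choice, while all chains of a family must have the
  same length. Its case \<open>q = 0\<close> says that every state starts chains of all lengths, which fill up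
  the remaining time.\<close>

lemma branches_from_power:
  fixes P :: "real set"
  assumes P: "P \<subseteq> X" and d: "0 < d"
    and down: "\<And>z. z \<in> P \<Longrightarrow> b < z \<Longrightarrow> \<exists>x\<in>P. (z, x) \<in> H \<and> x \<le> z - e"
    and up: "\<And>z. z \<in> P \<Longrightarrow> z \<le> b \<Longrightarrow> \<exists>x\<in>P. (z, x) \<in> H \<and> z + d \<le> x"
    and loop: "\<And>z. z \<in> P \<Longrightarrow> z \<le> b \<Longrightarrow> \<exists>x\<in>X. \<exists>y\<in>P. (z, x) \<in> H \<and> x \<le> z \<and> (x, y) \<in> H"
    and bound: "\<And>z. z \<in> P \<Longrightarrow> z \<le> b + real J * e"
    and z: "z \<in> P" "q * (J + 2) \<le> m"
  shows "branches_from X H d (2 ^ q) m z"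
  using z
proof (induction q arbitrary: z m)
  case 0
  have "branches_from X H d 1 m z" using 0(1)
  proof (induction m arbitrary: z)
    case 0
    thus ?case using P branches_from_0 by blast
  next
    case (Suc m)
    then obtain x where "x \<in> P" "(z, x) \<in> H" using up down by (meson not_le_imp_less)
    thus ?case using Suc P by (blast intro: branches_from_step)
  qed
  thus ?case by simp
next
  case (Suc q)
  have low: "branches_from X H d (2 ^ Suc q) m z" if "z \<in> P" "z \<le> b" "q * (J + 2) + 2 \<le> m" for z m
    using branches_from_double[OF P d up loop Suc.IH that] by simp
  show ?case
  proof (rule branches_from_descent[OF P down low])
    show "q * (J + 2) + 2 + J \<le> m" using Suc.prems(2) by simp
  qed (use Suc.prems bound in auto)
qed

section \<open>Well-aligned sets\<close>

lemma compact_pos_lower_bound: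
  fixes f :: "'a::topological_space \<Rightarrow> real"
  assumes "compact A" "continuous_on A f" "\<And>x. x \<in> A \<Longrightarrow> 0 < f x"
  obtains d where "0 < d" "\<And>x. x \<in> A \<Longrightarrow> d \<le> f x"
proof (cases "A = {}")
  case False
  then obtain x where "x \<in> A" "\<And>y. y \<in> A \<Longrightarrow> f x \<le> f y"
    using continuous_attains_inf[OF assms(1) _ assms(2)] by blast
  thus ?thesis using that[of "f x"] assms(3) by blast
qed (use that[of 1] in auto)

text \<open>The inclusion of \<open>L\<close> and \<open>R\<close> in \<open>H\<inverse>\<close> says that \<open>H\<close> contains all their moves from second to first
  coordinate; \<open>H\<close> is \<open>G\<inverse>\<close> for subsets of \<open>G\<close>, and \<open>G\<close> for subsets of \<open>G\<inverse>\<close>. Alignment provides moves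
  to states, and compactness makes them uniform. The descent is uniform because \<open>L\<close> lies
  strictly above the diagonal over the closed half-line from \<open>b\<close>, including height \<open>b\<close> itself: the
  open condition \<open>y > b\<close> would not cut out a compact set.\<close>

lemma well_aligned_separated_chains:
  assumes wa: "well_aligned L R" and sub: "L \<subseteq> H\<inverse>" "R \<subseteq> H\<inverse>"
  obtains d K where "0 < d" "0 < K"
    "\<And>q. \<exists>S\<subseteq>chain_lists unit_I H (q * K). card S = 2 ^ q \<and> separated d S"
proof -
  obtain b where "well_aligned_by b L R" using wa by (auto simp: well_aligned_def)
  hence clL: "closedin (top_of_set (unit_I \<times> unit_I)) L"
    and clR: "closedin (top_of_set (unit_I \<times> unit_I)) R"
    and ne: "part_above L b \<noteq> {}"
    and Lhi: "part_above L b \<union> part_at L b \<subseteq> Delta_above"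
    and Llo: "part_below L b \<subseteq> Delta_above \<union> Delta_diag"
    and RD: "R \<subseteq> Delta_below"
    and c3: "snd ` (part_below L b \<union> part_at L b) \<union> fst ` (part_below L b \<union> part_at L b) \<subseteq> snd ` R"
    and c4: "fst ` part_above L b \<union> fst ` R \<subseteq> snd ` L"
    unfolding well_aligned_by_def by - (elim conjE, assumption)+
  have LI: "L \<subseteq> unit_I \<times> unit_I" using clL by (rule closedin_imp_subset)
  have cI: "compact (unit_I \<times> unit_I :: (real \<times> real) set)" by (intro compact_Times) auto
  have cL: "compact L" and cR: "compact R" using closedin_compact[OF cI] clL clR by auto
  define P where "P = snd ` L"
  have PI: "P \<subseteq> unit_I" using LI by (auto simp: P_def)
  have closed_hi: "closed {p :: real \<times> real. b \<le> snd p}"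
    by (intro closed_Collect_le continuous_intros)
  obtain e where e: "0 < e" "\<And>p. p \<in> L \<inter> {p. b \<le> snd p} \<Longrightarrow> e \<le> snd p - fst p"
  proof (rule compact_pos_lower_bound[of "L \<inter> {p. b \<le> snd p}" "\<lambda>p. snd p - fst p"])
    show "compact (L \<inter> {p. b \<le> snd p})" using cL closed_hi by (rule compact_Int_closed)
    show "0 < snd p - fst p" if "p \<in> L \<inter> {p. b \<le> snd p}" for p
    proof -
      have "p \<in> part_above L b \<union> part_at L b"
        using that by (auto simp: part_above_def part_at_def)
      thus ?thesis using Lhi by (auto simp: Delta_above_def)
    qed
  qed (auto intro!: continuous_intros)
  obtain d where d: "0 < d" "\<And>p. p \<in> R \<Longrightarrow> d \<le> fst p - snd p"
  proof (rule compact_pos_lower_bound[of R "\<lambda>p. fst p - snd p"])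
    show "0 < fst p - snd p" if "p \<in> R" for p using RD that by (auto simp: Delta_below_def)
  qed (use cR in \<open>auto intro!: continuous_intros\<close>)
  \<comment> \<open>\<open>J\<close> descents by \<open>e\<close> lead from any point of the unit interval to a point at or below \<open>b\<close>.\<close>
  obtain J :: nat where J: "(1 - b) / e < real J" using reals_Archimedean2 by blast
  have "1 < b + real J * e" using J e by (simp add: field_simps)
  hence bound: "z \<le> b + real J * e" if "z \<in> P" for z using that PI by fastforce
  have low: "p \<in> part_below L b \<union> part_at L b" if "p \<in> L" "snd p \<le> b" for p
    using that by (auto simp: part_below_def part_at_def)
  \<comment> \<open>By alignment every \<open>R\<close>-move ends in a state.\<close>
  have R_move: "\<exists>x\<in>P. (z, x) \<in> H \<and> z + d \<le> x" if z: "z \<in> snd ` R" for z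
  proof -
    obtain p where p: "p \<in> R" "z = snd p" using z by blast
    have "fst p \<in> P" using p c4 by (auto simp: P_def)
    moreover have "(z, fst p) \<in> H" using p sub(2) by (metis converse_iff prod.collapse subsetD)
    moreover have "z + d \<le> fst p" using d(2)[OF p(1)] p(2) by simp
    ultimately show ?thesis by blast
  qed
  have down: "\<exists>x\<in>P. (z, x) \<in> H \<and> x \<le> z - e" if z: "z \<in> P" "b < z" for z
  proof -
    obtain p where p: "p \<in> L" "z = snd p" using z(1) by (auto simp: P_def)
    have "p \<in> part_above L b" using p z(2) by (auto simp: part_above_def)
    hence "fst p \<in> P" using c4 by (auto simp: P_def)
    moreover have "(z, fst p) \<in> H" using p sub(1) by (metis converse_iff prod.collapse subsetD)
    moreover have "fst p \<le> z - e" using e(2)[of p] p z(2) by simp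
    ultimately show ?thesis by blast
  qed
  have up: "\<exists>x\<in>P. (z, x) \<in> H \<and> z + d \<le> x" if z: "z \<in> P" "z \<le> b" for z
    using R_move c3 low that unfolding P_def by blast
  have loop: "\<exists>x\<in>unit_I. \<exists>y\<in>P. (z, x) \<in> H \<and> x \<le> z \<and> (x, y) \<in> H" if z: "z \<in> P" "z \<le> b" for z
  proof -
    obtain p where p: "p \<in> L" "z = snd p" using z(1) by (auto simp: P_def)
    hence p': "p \<in> part_below L b \<union> part_at L b" using low z by blast
    hence "fst p \<in> snd ` R" using c3 by blast
    then obtain y where y: "y \<in> P" "(fst p, y) \<in> H" using R_move by blast
    have "fst p \<le> snd p"
      using p' Lhi Llo by (auto simp: Delta_above_def Delta_diag_def)
    moreover have "fst p \<in> unit_I" using p LI by auto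
    moreover have "(z, fst p) \<in> H" using p sub(1) by (metis converse_iff prod.collapse subsetD)
    ultimately show ?thesis using y p by blast
  qed
  obtain z where z: "z \<in> P" using ne by (auto simp: P_def part_above_def)
  show ?thesis
  proof (rule that[of d "J + 2"])
    fix q
    have "branches_from unit_I H d (2 ^ q) (q * (J + 2)) z"
      using branches_from_power[OF PI d(1) down up loop bound z] by simp
    thus "\<exists>S\<subseteq>chain_lists unit_I H (q * (J + 2)). card S = 2 ^ q \<and> separated d S"
      by (auto simp: branches_from_def)
  qed (use d in auto)
qed

theorem theorem6p9:
  fixes G :: "(real \<times> real) set"
  assumes "closed_relation_on unit_I G"
    and "(\<exists>L R. closedin (top_of_set G) L \<and> closedin (top_of_set G) R \<and> well_aligned L R) \<or>
         (\<exists>L R. closedin (top_of_set (G\<inverse>)) L \<and> closedin (top_of_set (G\<inverse>)) R \<and> well_aligned L R)"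
  shows "ent unit_I G \<noteq> 0"
proof -
  have nonempty: "L \<noteq> {}" if "well_aligned L R" for L R :: "(real \<times> real) set"
    using that by (auto simp: well_aligned_def well_aligned_by_def part_above_def)
  have "\<exists>d K. 0 < d \<and> 0 < K \<and> G \<noteq> {} \<and>
      (\<forall>q. \<exists>S\<subseteq>chain_lists unit_I (G\<inverse>) (q * K). card S = 2 ^ q \<and> separated d S)"
    using assms(2)
  proof
    assume "\<exists>L R. closedin (top_of_set G) L \<and> closedin (top_of_set G) R \<and> well_aligned L R"
    then obtain L R where LR: "L \<subseteq> G" "R \<subseteq> G" "well_aligned L R"
      by (meson closedin_imp_subset)
    obtain d K where "0 < d" "0 < K"
        "\<And>q. \<exists>S\<subseteq>chain_lists unit_I (G\<inverse>) (q * K). card S = 2 ^ q \<and> separated d S"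
      using well_aligned_separated_chains[OF LR(3), of "G\<inverse>"] LR(1,2) by auto
    thus ?thesis using LR(1) nonempty[OF LR(3)] by blast
  next
    assume "\<exists>L R. closedin (top_of_set (G\<inverse>)) L \<and> closedin (top_of_set (G\<inverse>)) R \<and> well_aligned L R"
    then obtain L R where LR: "L \<subseteq> G\<inverse>" "R \<subseteq> G\<inverse>" "well_aligned L R"
      by (meson closedin_imp_subset)
    obtain d K where dK: "0 < d" "0 < K"
        "\<And>q. \<exists>S\<subseteq>chain_lists unit_I G (q * K). card S = 2 ^ q \<and> separated d S"
      using well_aligned_separated_chains[OF LR(3,1,2)] by auto
    have "\<exists>S\<subseteq>chain_lists unit_I (G\<inverse>) (q * K). card S = 2 ^ q \<and> separated d S" for q
      using dK(3)[of q] separated_rev_chain_lists by metis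
    thus ?thesis using dK(1,2) LR(1) nonempty[OF LR(3)] by blast
  qed
  then obtain d K where "0 < d" "0 < K" "G \<noteq> {}"
      "\<And>q. \<exists>S\<subseteq>chain_lists unit_I (G\<inverse>) (q * K). card S = 2 ^ q \<and> separated d S"
    by blast
  hence "0 < ent unit_I G" by (intro ent_pos_of_separated_chains) auto
  thus ?thesis by simp
qed

end
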